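(* Let $n\geq 2$ be even. Then for each $1\leq k\leq 4$, the smallest size of a $k$-strong defining set of $B_n$ is $kn^2/4$.
   Context: $B_n$ is the Latin square of order $n$ with rows, columns and symbols indexed by $\mathbb{Z}_n$, given by $B_n=\{(i,j;i+j \bmod n): i,j\in\mathbb{Z}_n\}$ (triples are (row, column; symbol)). A partial Latin square (PLS) is an array in which some cells may be empty and each symbol occurs at most once per row and column. A Latin trade in a Latin square $L$ is a non-empty PLS $T\subseteq L$ for which there is a PLS $T'$ of the same order with $T\cap T'=\emptyset$, the same set of non-empty cells as $T$, and the same set of symbols as $T$ in each row and in each column. A defining set of $L$ is a subset of $L$ contained in no other Latin square of the same order. A defining set $D$ of $L$ is $k$-strong if $|D\cap T|\geq k$ for every Latin trade $T\subseteq L$. *)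

theory Defs
  imports Complex_Main
begin

text \<open>
  Arrays of order \<open>n\<close> are sets of triples (row, column, symbol) of naturals, with
  \<open>{0..<n}\<close> representing the integers modulo \<open>n\<close>.
\<close>

type_synonym array = "(nat \<times> nat \<times> nat) set"

definition partial_latin_square :: "nat \<Rightarrow> array \<Rightarrow> bool" where
  "partial_latin_square n P \<longleftrightarrow>
     P \<subseteq> {0..<n} \<times> {0..<n} \<times> {0..<n} \<and>
     (\<forall>r c s s'. (r, c, s) \<in> P \<longrightarrow> (r, c, s') \<in> P \<longrightarrow> s = s') \<and>
     (\<forall>r c c' s. (r, c, s) \<in> P \<longrightarrow> (r, c', s) \<in> P \<longrightarrow> c = c') \<and>
     (\<forall>r r' c s. (r, c, s) \<in> P \<longrightarrow> (r', c, s) \<in> P \<longrightarrow> r = r')"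

definition filled_cells :: "array \<Rightarrow> (nat \<times> nat) set" where
  "filled_cells P = {(r, c). \<exists>s. (r, c, s) \<in> P}"

definition row_symbols :: "array \<Rightarrow> nat \<Rightarrow> nat set" where
  "row_symbols P r = {s. \<exists>c. (r, c, s) \<in> P}"

definition column_symbols :: "array \<Rightarrow> nat \<Rightarrow> nat set" where
  "column_symbols P c = {s. \<exists>r. (r, c, s) \<in> P}"

definition latin_square :: "nat \<Rightarrow> array \<Rightarrow> bool" where
  "latin_square n L \<longleftrightarrow>
     partial_latin_square n L \<and> filled_cells L = {0..<n} \<times> {0..<n}"

definition back_circulant :: "nat \<Rightarrow> array" where
  "back_circulant n = {(i, j, (i + j) mod n) | i j. i < n \<and> j < n}"

definition latin_trade :: "nat \<Rightarrow> array \<Rightarrow> array \<Rightarrow> bool" where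
  "latin_trade n L T \<longleftrightarrow>
     T \<noteq> {} \<and> partial_latin_square n T \<and> T \<subseteq> L \<and>
     (\<exists>T'. partial_latin_square n T' \<and> T \<inter> T' = {} \<and>
        filled_cells T' = filled_cells T \<and>
        (\<forall>r<n. row_symbols T' r = row_symbols T r) \<and>
        (\<forall>c<n. column_symbols T' c = column_symbols T c))"

definition defining_set :: "nat \<Rightarrow> array \<Rightarrow> array \<Rightarrow> bool" where
  "defining_set n L D \<longleftrightarrow>
     D \<subseteq> L \<and> (\<forall>L'. latin_square n L' \<and> D \<subseteq> L' \<longrightarrow> L' = L)"

definition strong_defining_set :: "nat \<Rightarrow> nat \<Rightarrow> array \<Rightarrow> array \<Rightarrow> bool" where
  "strong_defining_set k n L D \<longleftrightarrow>
     defining_set n L D \<and> (\<forall>T. latin_trade n L T \<longrightarrow> k \<le> card (D \<inter> T))"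

text \<open>Arithmetic modulo \<open>n\<close> on naturals indeed makes \<open>back_circulant n\<close> a Latin square, for every \<open>n\<close>.\<close>

lemma add_mod_left_cancel:
  fixes n :: nat
  assumes "(a + b) mod n = (a + c) mod n" "b < n" "c < n"
  shows "b = c"
proof -
  have "(int a + int b) mod int n = (int a + int c) mod int n"
    using arg_cong[OF assms(1), of int] by (simp only: zmod_int of_nat_add)
  then have "(int a + int b - int a) mod int n = (int a + int c - int a) mod int n"
    by (rule mod_diff_cong) (rule refl)
  then show ?thesis using assms(2,3) by simp
qed

lemma latin_square_back_circulant: "latin_square n (back_circulant n)"
proof -
  have "c = c'" if "(r + c) mod n = (r + c') mod n" "c < n" "c' < n" for r c c'
    using that by (rule add_mod_left_cancel)
  moreover have "r = r'" if "(r + c) mod n = (r' + c) mod n" "r < n" "r' < n" for r r' c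
    using that add_mod_left_cancel[of c r n r'] by (simp add: add.commute)
  moreover have "filled_cells (back_circulant n) = {0..<n} \<times> {0..<n}"
    unfolding filled_cells_def back_circulant_def by auto
  moreover have "back_circulant n \<subseteq> {0..<n} \<times> {0..<n} \<times> {0..<n}"
    unfolding back_circulant_def by auto
  moreover have "(r, c, s) \<in> back_circulant n \<longleftrightarrow> r < n \<and> c < n \<and> s = (r + c) mod n" for r c s
    unfolding back_circulant_def by auto
  ultimately show ?thesis
    unfolding latin_square_def partial_latin_square_def by metis
qed

end

theory Submission
  imports Defs
begin

text \<open>
  Write \<open>n = 2h\<close>. The \<open>h\<^sup>2\<close> subsquares on rows \<open>i, i + h\<close> and columns \<open>j, j + h\<close> are
  intercalates, hence trades, and they partition \<open>B\<^sub>n\<close>; this gives the lower bound.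

  For the upper bound, let \<open>D\<close> consist of the cells with \<open>i + j < h\<close> or \<open>i + j \<ge> 3h\<close>. Off \<open>D\<close>,
  the sums \<open>i + j\<close> lie in a window of length \<open>n\<close>, so the symbol determines the integer \<open>i + j\<close>, and a
  trade avoiding \<open>D\<close> would be a finite trade in the addition table of the integers. There is none:
  for the largest symbol of the trade, the row plus column sums over its cells in the trade and in
  the mate would differ. The same holds for the four translates of \<open>D\<close> by multiples of \<open>h\<close> in
  both coordinates, which partition \<open>B\<^sub>n\<close> and meet each of the above intercalates in one
  cell. The union of \<open>k\<close> of them is an optimal \<open>k\<close>-strong defining set.
\<close>

section \<open>Latin trades: an obstruction and a source\<close>

lemma back_circulant_iff:
  "(r, c, s) \<in> back_circulant n \<longleftrightarrow> r < n \<and> c < n \<and> s = (r + c) mod n"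
  unfolding back_circulant_def by auto

lemma finite_partial_latin_square: "partial_latin_square n P \<Longrightarrow> finite P"
  unfolding partial_latin_square_def
  using finite_subset[of P "{0..<n} \<times> {0..<n} \<times> {0..<n}"] by simp

text \<open>\<open>f\<close>, \<open>g\<close> and \<open>e\<close> relabel rows, columns and
  symbols by naturals, so that a trade in a cyclic table can be handled as one in an ordinary
  addition table, where order is available.\<close>

lemma latin_trade_nonlinear:
  fixes f g e :: "nat \<Rightarrow> nat"
  assumes trade: "latin_trade n L T"
    and inj: "inj_on e {..<n}"
    and eq: "\<And>r c s. (r, c, s) \<in> T \<Longrightarrow> f r + g c = e s"
  shows False
proof -
  from trade obtain T' where "T \<noteq> {}" and T: "partial_latin_square n T"
    and T': "partial_latin_square n T'" and disj: "T \<inter> T' = {}"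
    and cells: "filled_cells T' = filled_cells T"
    and rows: "\<And>r. r < n \<Longrightarrow> row_symbols T' r = row_symbols T r"
    and cols: "\<And>c. c < n \<Longrightarrow> column_symbols T' c = column_symbols T c"
    unfolding latin_trade_def by blast
  define S where "S = {s. \<exists>r c. (r, c, s) \<in> T}"
  have S: "S \<noteq> {}" "S \<subseteq> {..<n}"
    using \<open>T \<noteq> {}\<close> T unfolding S_def partial_latin_square_def by auto
  then have "finite S" using finite_subset by blast
  then obtain s where s: "s \<in> S" and smax: "\<And>s'. s' \<in> S \<Longrightarrow> e s' \<le> e s"
    using S(1) Max_in[of "e ` S"] Max_ge[of "e ` S"] by fastforce
  define cell where "cell P = {(r, c). (r, c, s) \<in> P}" for P :: array
  have fin: "finite (cell P)" if "partial_latin_square n P" for P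
    by (rule finite_subset[of _ "{0..<n} \<times> {0..<n}"])
      (use that in \<open>auto simp: cell_def partial_latin_square_def\<close>)
  \<comment> \<open>A symbol occurs at most once per row and column, so the cells of
    \<open>s\<close> project injectively to both coordinates. The sum then depends only on which
    rows and columns contain \<open>s\<close>, and these agree for \<open>T\<close> and
    \<open>T'\<close>.\<close>
  have split: "(\<Sum>(r, c)\<in>cell P. f r + g c) = sum f (fst ` cell P) + sum g (snd ` cell P)"
    if P: "partial_latin_square n P" for P
  proof -
    have "inj_on fst (cell P)" "inj_on snd (cell P)"
      using P unfolding partial_latin_square_def cell_def inj_on_def by auto
    then show ?thesis
      by (simp add: sum.reindex case_prod_unfold sum.distrib)
  qed
  have bound: "r < n" "c < n" if "(r, c, t) \<in> T \<union> T'" for r c t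
    using that T T' unfolding partial_latin_square_def by auto
  have "r \<in> fst ` cell T' \<longleftrightarrow> r \<in> fst ` cell T" for r
    using rows[of r] bound unfolding cell_def row_symbols_def image_def by auto
  then have fst_eq: "fst ` cell T' = fst ` cell T" by blast
  have "c \<in> snd ` cell T' \<longleftrightarrow> c \<in> snd ` cell T" for c
    using cols[of c] bound unfolding cell_def column_symbols_def image_def by auto blast+
  then have "snd ` cell T' = snd ` cell T" by blast
  with fst_eq have sums: "(\<Sum>(r, c)\<in>cell T'. f r + g c) = (\<Sum>(r, c)\<in>cell T. f r + g c)"
    using split[OF T] split[OF T'] by simp
  \<comment> \<open>By disjointness this cell holds a symbol other than \<open>s\<close> in
    \<open>T\<close>. The label of that symbol is the sum at the cell, and it lies below the maximal
    label \<open>e s\<close>.\<close>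
  have less: "f r + g c < e s" if rc: "(r, c, s) \<in> T'" for r c
  proof -
    from rc obtain s' where s': "(r, c, s') \<in> T"
      using cells unfolding filled_cells_def by (auto simp: set_eq_iff)
    then have "s' \<in> S" "s' \<noteq> s" using disj rc unfolding S_def by auto
    then have "e s' < e s"
      using smax[of s'] inj s S(2) by (metis inj_onD le_neq_implies_less subsetD)
    with eq[OF s'] show ?thesis by simp
  qed
  have "card (cell T') = card (cell T)"
  proof -
    have "card (cell P) = card (fst ` cell P)" if "partial_latin_square n P" for P
      using that unfolding partial_latin_square_def cell_def
      by (intro card_image[symmetric]) (auto simp: inj_on_def)
    with T T' fst_eq show ?thesis by metis
  qed
  moreover have "(\<Sum>(r, c)\<in>cell T. f r + g c) = (\<Sum>(r, c)\<in>cell T. e s)"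
    by (rule sum.cong) (use eq in \<open>auto simp: cell_def\<close>)
  moreover have "(\<Sum>(r, c)\<in>cell T'. f r + g c) < (\<Sum>(r, c)\<in>cell T'. e s)"
  proof (rule sum_strict_mono)
    show "finite (cell T')" using fin[OF T'] .
    have "cell T \<noteq> {}" using s unfolding S_def cell_def by blast
    then show "cell T' \<noteq> {}" using fst_eq by (metis image_is_empty)
  qed (use less in \<open>auto simp: cell_def\<close>)
  ultimately show False using sums by (simp add: case_prod_unfold)
qed

text \<open>The mate is \<open>L' - L\<close>. This turns a second completion of a partial square
  into a trade that avoids it.\<close>

lemma difference_latin_trade:
  assumes L: "latin_square n L" and L': "latin_square n L'" and "L' \<noteq> L"
  shows "latin_trade n L (L - L')"
proof -
  have pL: "partial_latin_square n L" and pL': "partial_latin_square n L'"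
    using L L' unfolding latin_square_def by auto
  have sub: "partial_latin_square n P" if "partial_latin_square n Q" "P \<subseteq> Q" for P Q
    using that unfolding partial_latin_square_def by (meson subsetD subset_trans)
  have cell: "\<exists>s. (r, c, s) \<in> M" if "latin_square n M" "r < n" "c < n" for M r c
    using that unfolding latin_square_def filled_cells_def by (auto simp: set_eq_iff)
  have uniq: "s = s'" if "partial_latin_square n M" "(r, c, s) \<in> M" "(r, c, s') \<in> M" for M r c s s'
    using that unfolding partial_latin_square_def by blast
  have uniq_c: "c = c'" if "partial_latin_square n M" "(r, c, s) \<in> M" "(r, c', s) \<in> M" for M r c c' s
    using that unfolding partial_latin_square_def by blast
  have uniq_r: "r = r'" if "partial_latin_square n M" "(r, c, s) \<in> M" "(r', c, s) \<in> M" for M r r' c s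
    using that unfolding partial_latin_square_def by blast
  have bd: "r < n \<and> c < n \<and> s < n" if "partial_latin_square n M" "(r, c, s) \<in> M" for M r c s
    using that unfolding partial_latin_square_def by auto
  \<comment> \<open>A row is an injective map from \<open>n\<close> columns to \<open>n\<close>
    symbols, hence onto.\<close>
  have row: "\<exists>c. (r, c, s) \<in> M" if M: "latin_square n M" "r < n" "s < n" for M r s
  proof -
    have pM: "partial_latin_square n M" using M(1) unfolding latin_square_def by simp
    obtain F where F: "\<And>c. c < n \<Longrightarrow> (r, c, F c) \<in> M" using cell[OF M(1,2)] by metis
    have "inj_on F {..<n}" using F uniq_c[OF pM] by (metis inj_onI lessThan_iff)
    moreover have "F ` {..<n} \<subseteq> {..<n}" using F bd[OF pM] by auto
    ultimately have "F ` {..<n} = {..<n}" by (simp add: endo_inj_surj)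
    with F M(3) show ?thesis by (metis imageE lessThan_iff)
  qed
  have col: "\<exists>r. (r, c, s) \<in> M" if M: "latin_square n M" "c < n" "s < n" for M c s
  proof -
    have pM: "partial_latin_square n M" using M(1) unfolding latin_square_def by simp
    obtain F where F: "\<And>r. r < n \<Longrightarrow> (r, c, F r) \<in> M" using cell[OF M(1) _ M(2)] by metis
    have "inj_on F {..<n}" using F uniq_r[OF pM] by (metis inj_onI lessThan_iff)
    moreover have "F ` {..<n} \<subseteq> {..<n}" using F bd[OF pM] by auto
    ultimately have "F ` {..<n} = {..<n}" by (simp add: endo_inj_surj)
    with F M(3) show ?thesis by (metis imageE lessThan_iff)
  qed
  \<comment> \<open>A symbol of row \<open>r\<close> in \<open>M - N\<close> also occurs in row
    \<open>r\<close> of \<open>N\<close>. That triple is not in \<open>M\<close>, which already has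
    the symbol elsewhere in the row. Columns and cells are analogous, and exchanging
    \<open>M\<close> and \<open>N\<close> yields equality.\<close>
  have half: "filled_cells (M - N) \<subseteq> filled_cells (N - M)"
    "row_symbols (M - N) r \<subseteq> row_symbols (N - M) r"
    "column_symbols (M - N) r \<subseteq> column_symbols (N - M) r"
    if M: "latin_square n M" and N: "latin_square n N" for M N r
  proof -
    have pM: "partial_latin_square n M" and pN: "partial_latin_square n N"
      using M N unfolding latin_square_def by auto
    show "filled_cells (M - N) \<subseteq> filled_cells (N - M)"
      using cell[OF N] bd[OF pM] uniq[OF pM] unfolding filled_cells_def by auto metis
    show "row_symbols (M - N) r \<subseteq> row_symbols (N - M) r"
      using row[OF N] bd[OF pM] uniq_c[OF pM] unfolding row_symbols_def by auto metis
    show "column_symbols (M - N) r \<subseteq> column_symbols (N - M) r"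
      using col[OF N] bd[OF pM] uniq_r[OF pM] unfolding column_symbols_def by auto metis
  qed
  have "L - L' \<noteq> {}"
  proof
    assume "L - L' = {}"
    then have "L \<subseteq> L'" by blast
    moreover have "L' \<subseteq> L"
    proof
      fix x assume x: "x \<in> L'"
      obtain r c s where rcs: "x = (r, c, s)" by (cases x)
      with x have "(r, c, s) \<in> L'" by simp
      moreover obtain s' where "(r, c, s') \<in> L" using cell[OF L] bd[OF pL' calculation] by blast
      moreover have "(r, c, s') \<in> L'" using calculation(2) \<open>L \<subseteq> L'\<close> by blast
      ultimately show "x \<in> L" using uniq[OF pL'] rcs by metis
    qed
    ultimately show False using \<open>L' \<noteq> L\<close> by blast
  qed
  moreover have "partial_latin_square n (L - L')" "partial_latin_square n (L' - L)"
    using sub pL pL' by blast+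
  moreover have "filled_cells (L' - L) = filled_cells (L - L')"
    "\<And>r. row_symbols (L' - L) r = row_symbols (L - L') r"
    "\<And>r. column_symbols (L' - L) r = column_symbols (L - L') r"
    using half[OF L L'] half[OF L' L] by blast+
  ultimately show ?thesis
    unfolding latin_trade_def by (intro conjI exI[of _ "L' - L"]) auto
qed

text \<open>Meeting every trade already forces unique completion: another Latin square
  \<open>L'\<close> containing \<open>D\<close> would give the trade \<open>L - L'\<close>, which is
  disjoint from \<open>D\<close>.\<close>

lemma strong_defining_setI:
  assumes L: "latin_square n L" and "D \<subseteq> L" and "1 \<le> k"
    and meet: "\<And>T. latin_trade n L T \<Longrightarrow> k \<le> card (D \<inter> T)"
  shows "strong_defining_set k n L D"
proof -
  have "L' = L" if "latin_square n L'" "D \<subseteq> L'" for L'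
  proof (rule ccontr)
    assume "L' \<noteq> L"
    then have "k \<le> card (D \<inter> (L - L'))"
      using meet difference_latin_trade[OF L that(1)] by blast
    moreover have "D \<inter> (L - L') = {}" using that(2) by blast
    ultimately show False using \<open>1 \<le> k\<close> by simp
  qed
  then show ?thesis
    using assms unfolding strong_defining_set_def defining_set_def by blast
qed

section \<open>The partition into intercalates\<close>

definition intercalate :: "nat \<Rightarrow> nat \<Rightarrow> nat \<Rightarrow> array" where
  "intercalate h i j =
    {(i, j, (i + j) mod (2 * h)), (i, j + h, (i + j + h) mod (2 * h)),
     (i + h, j, (i + j + h) mod (2 * h)), (i + h, j + h, (i + j) mod (2 * h))}"

lemma intercalate_latin_trade:
  assumes "i < h" "j < h"
  shows "latin_trade (2 * h) (back_circulant (2 * h)) (intercalate h i j)"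
proof -
  define s s' where "s = (i + j) mod (2 * h)" and "s' = (i + j + h) mod (2 * h)"
  have "h > 0" using assms by simp
  \<comment> \<open>Two shifts by \<open>h\<close> cancel modulo \<open>2 * h\<close>, so opposite
    corners carry the same symbol.\<close>
  have add_shifts: "(i + h + (j + h)) mod (2 * h) = (i + j) mod (2 * h)"
    using mod_add_self2[of "i + j" "2 * h"] by (metis add.assoc add.left_commute mult_2)
  have bound: "s < 2 * h" "s' < 2 * h"
    using assms unfolding s_def s'_def by auto
  have "s \<noteq> s'"
    using add_mod_left_cancel[of "i + j" 0 "2 * h" h] \<open>h > 0\<close> unfolding s_def s'_def by auto
  have I: "intercalate h i j = {(i, j, s), (i, j + h, s'), (i + h, j, s'), (i + h, j + h, s)}"
    unfolding intercalate_def s_def s'_def ..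
  \<comment> \<open>The mate exchanges the two symbols.\<close>
  define I' where "I' = {(i, j, s'), (i, j + h, s), (i + h, j, s), (i + h, j + h, s')}"
  have "intercalate h i j \<subseteq> back_circulant (2 * h)"
    using assms add_shifts unfolding intercalate_def
    by (auto simp: back_circulant_iff ac_simps)
  moreover have "partial_latin_square (2 * h) (intercalate h i j)" "partial_latin_square (2 * h) I'"
    using assms bound \<open>s \<noteq> s'\<close> \<open>h > 0\<close> unfolding I I'_def partial_latin_square_def by auto
  moreover have "filled_cells I' = filled_cells (intercalate h i j)"
    unfolding I I'_def filled_cells_def by auto
  moreover have "row_symbols I' r = row_symbols (intercalate h i j) r"
    "column_symbols I' r = column_symbols (intercalate h i j) r" for r
    unfolding I I'_def row_symbols_def column_symbols_def by auto
  moreover have "intercalate h i j \<inter> I' = {}"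
    using \<open>s \<noteq> s'\<close> \<open>h > 0\<close> unfolding I I'_def by auto
  ultimately show ?thesis
    unfolding latin_trade_def by (auto simp: I intro!: exI[of _ I'])
qed

text \<open>The intercalates are the fibres of the map \<open>p\<close> that reduces row and column
  modulo \<open>h\<close>.\<close>

lemma card_eq_sum_intercalates:
  assumes "D \<subseteq> back_circulant (2 * h)" "h > 0"
  shows "card D = (\<Sum>(i, j)\<in>{..<h} \<times> {..<h}. card (D \<inter> intercalate h i j))"
proof -
  define p :: "nat \<times> nat \<times> nat \<Rightarrow> nat \<times> nat" where "p = (\<lambda>(r, c, s). (r mod h, c mod h))"
  have "partial_latin_square (2 * h) (back_circulant (2 * h))"
    using latin_square_back_circulant unfolding latin_square_def by blast
  then have "finite D"
    using assms(1) finite_partial_latin_square finite_subset by blast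
  have half: "r = r mod h \<or> r = r mod h + h" if "r < 2 * h" for r
    using that le_mod_geq[of h r] by (cases "r < h") auto
  have fibre: "{x \<in> D. p x = (i, j)} = D \<inter> intercalate h i j" if "i < h" "j < h" for i j
  proof (rule set_eqI)
    fix x :: "nat \<times> nat \<times> nat"
    obtain r c s where x: "x = (r, c, s)" by (cases x)
    have "x \<in> intercalate h i j" if "x \<in> D" "p x = (i, j)"
    proof -
      have s: "s = (r + c) mod (2 * h)" and rc: "r = i \<or> r = i + h" "c = j \<or> c = j + h"
        using that assms(1) half[of r] half[of c] unfolding x p_def by (auto simp: back_circulant_iff)
      have "(i + h + (j + h)) mod (2 * h) = (i + j) mod (2 * h)"
        using mod_add_self2[of "i + j" "2 * h"] by (metis add.assoc add.left_commute mult_2)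
      with rc show ?thesis unfolding x s intercalate_def by (auto simp: ac_simps)
    qed
    moreover have "p x = (i, j)" if "x \<in> intercalate h i j"
      using that \<open>i < h\<close> \<open>j < h\<close> unfolding intercalate_def p_def by auto
    ultimately show "x \<in> {x \<in> D. p x = (i, j)} \<longleftrightarrow> x \<in> D \<inter> intercalate h i j" by blast
  qed
  have "p ` D \<subseteq> {..<h} \<times> {..<h}" using \<open>h > 0\<close> unfolding p_def by auto
  from sum.group[OF \<open>finite D\<close> _ this, of "\<lambda>_. 1 :: nat"]
  have "card D = (\<Sum>q\<in>{..<h} \<times> {..<h}. card {x \<in> D. p x = q})" by simp
  also have "\<dots> = (\<Sum>(i, j)\<in>{..<h} \<times> {..<h}. card (D \<inter> intercalate h i j))"
    by (rule sum.cong) (auto simp: fibre)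
  finally show ?thesis .
qed

section \<open>The four colour classes\<close>

text \<open>
  Colour \<open>2\<alpha> + \<beta>\<close> is the translate of the basic defining set by \<open>(\<alpha>h, \<beta>h)\<close>.
\<close>

definition colour :: "nat \<Rightarrow> nat \<times> nat \<times> nat \<Rightarrow> nat" where
  "colour h = (\<lambda>(r, c, s).
    if r mod h + c mod h < h then 2 * (r div h) + c div h else 3 - (2 * (r div h) + c div h))"

text \<open>The four cells share their residues modulo \<open>h\<close>, hence the branch of
  \<open>colour\<close>. Their quadrant numbers are 0 to 3, and the other branch only reverses
  these, so each colour occurs once.\<close>

lemma card_colours_intercalate:
  assumes "i < h" "j < h" "k \<le> 4"
  shows "card {x \<in> intercalate h i j. colour h x < k} = k"
proof -
  have "inj_on (colour h) (intercalate h i j)"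
    using assms unfolding intercalate_def inj_on_def colour_def by (auto split: if_splits)
  moreover have "colour h ` intercalate h i j = {0, 1, 2, 3}"
    using assms unfolding intercalate_def colour_def by auto
  moreover have "colour h ` {x \<in> intercalate h i j. colour h x < k} =
      colour h ` intercalate h i j \<inter> {..<k}"
    by blast
  moreover have "{0, 1, 2, 3} \<inter> {..<k} = {..<k}" using assms(3) by auto
  ultimately show ?thesis
    by (metis (no_types, lifting) card_image card_lessThan inj_on_subset mem_Collect_eq subsetI)
qed

text \<open>\<open>m\<close> is the sum of the translated coordinates: the residues modulo
  \<open>h\<close> plus \<open>h\<close> for each of the two quotients that differs from its target
  \<alpha> or \<beta>. Colour 2\<alpha> + \<beta> means residue sum below \<open>h\<close> with no
  mismatch, or at least \<open>h\<close> with two. Every other case lands in the window.\<close>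

lemma window_of_other_colour:
  assumes "r < 2 * h" "c < 2 * h" "\<alpha> \<le> 1" "\<beta> \<le> 1" "colour h (r, c, s) \<noteq> 2 * \<alpha> + \<beta>"
  defines "m \<equiv> (r + h * \<alpha>) mod (2 * h) + (c + h * \<beta>) mod (2 * h)"
  shows "h \<le> m" "m < 3 * h"
proof -
  have shift: "(x + h * \<gamma>) mod (2 * h) = (if x div h = \<gamma> then x mod h else x mod h + h)
      \<and> x div h \<le> 1" if "x < 2 * h" "\<gamma> \<le> 1" for x \<gamma>
  proof -
    have "\<gamma> = 0 \<or> \<gamma> = 1" using that by auto
    moreover have "x div h = 0 \<and> x mod h = x" if "x < h" using that by simp
    moreover have "x div h = 1 \<and> x mod h = x - h" if "\<not> x < h"
      using that \<open>x < 2 * h\<close> by (simp add: le_div_geq le_mod_geq)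
    ultimately show ?thesis using that
      by (cases "x < h") (auto simp: le_mod_geq)
  qed
  obtain i j where "r mod h = i" "c mod h = j" "i < h" "j < h" using assms by auto
  then show "h \<le> m" "m < 3 * h"
    using shift[OF assms(1,3)] shift[OF assms(2,4)] assms(3-5) unfolding m_def colour_def
    by (auto split: if_splits simp: le_Suc_eq)
qed

lemma latin_trade_meets_colour:
  assumes trade: "latin_trade (2 * h) (back_circulant (2 * h)) T" and "h > 0" "t < 4"
  shows "\<exists>x\<in>T. colour h x = t"
proof (rule ccontr)
  assume none: "\<not> (\<exists>x\<in>T. colour h x = t)"
  define \<alpha> \<beta> where "\<alpha> = t div 2" and "\<beta> = t mod 2"
  have t: "t = 2 * \<alpha> + \<beta>" "\<alpha> \<le> 1" "\<beta> \<le> 1"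
    using \<open>t < 4\<close> unfolding \<alpha>_def \<beta>_def by auto
  define f where "f r = (r + h * \<alpha>) mod (2 * h)" for r
  define g where "g c = (c + h * \<beta>) mod (2 * h)" for c
  \<comment> \<open>The representative in the window from \<open>h\<close> to
    \<open>3 * h - 1\<close> of the translated symbol. The inner \<open>h\<close> stands for a
    subtraction of \<open>h\<close>, which is the same modulo \<open>2 * h\<close>.\<close>
  define e where "e s = h + (h * \<alpha> + h * \<beta> + h + s) mod (2 * h)" for s
  have "inj_on e {..<2 * h}"
    unfolding e_def by (auto intro!: inj_onI dest: add_mod_left_cancel)
  moreover have "f r + g c = e s" if "(r, c, s) \<in> T" for r c s
  proof -
    have "(r, c, s) \<in> back_circulant (2 * h)" using that trade unfolding latin_trade_def by blast
    then have rc: "r < 2 * h" "c < 2 * h" and s: "s = (r + c) mod (2 * h)"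
      by (auto simp: back_circulant_iff)
    have "colour h (r, c, s) \<noteq> 2 * \<alpha> + \<beta>" using none that t(1) by blast
    from window_of_other_colour[OF rc t(2,3) this]
    have window: "h \<le> f r + g c" "f r + g c < 3 * h" unfolding f_def g_def by auto
    have "(f r + g c + h) mod (2 * h) = ((r + h * \<alpha>) + (c + h * \<beta>) + h) mod (2 * h)"
      unfolding f_def g_def by (metis mod_add_eq mod_add_left_eq)
    also have "\<dots> = (h * \<alpha> + h * \<beta> + h + (r + c)) mod (2 * h)"
      by (simp add: ac_simps)
    also have "\<dots> = (h * \<alpha> + h * \<beta> + h + s) mod (2 * h)"
      unfolding s by (simp add: mod_add_right_eq)
    finally have "e s = h + (f r + g c + h) mod (2 * h)" unfolding e_def by simp
    \<comment> \<open>The window puts the left sum between \<open>2 * h\<close> and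
      \<open>4 * h - 1\<close>, so reduction subtracts \<open>2 * h\<close> exactly once.\<close>
    also have "(f r + g c + h) mod (2 * h) = f r + g c - h"
      using window le_mod_geq[of "2 * h" "f r + g c + h"] by simp
    finally show ?thesis using window by simp
  qed
  ultimately show False by (rule latin_trade_nonlinear[OF trade])
qed

section \<open>Matching upper and lower bounds\<close>

theorem theorem4:
  fixes n k :: nat
  assumes "n \<ge> 2" and "even n" and "1 \<le> k" and "k \<le> 4"
  shows "(\<exists>D. strong_defining_set k n (back_circulant n) D \<and>
              real (card D) = real k * real n ^ 2 / 4) \<and>
         (\<forall>D. strong_defining_set k n (back_circulant n) D \<longrightarrow>
              real k * real n ^ 2 / 4 \<le> real (card D))"
proof (intro conjI allI impI)
  obtain h where n: "n = 2 * h" using \<open>even n\<close> by blast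
  then have "h > 0" using \<open>n \<ge> 2\<close> by simp
  have size: "real k * real n ^ 2 / 4 = real (h * h * k)"
    by (simp add: n power2_eq_square)
  define D where "D = {x \<in> back_circulant n. colour h x < k}"
  have "D \<subseteq> back_circulant (2 * h)" unfolding D_def n by blast
  \<comment> \<open>The trade lemma is used here only to place the intercalate inside the
    square.\<close>
  have "D \<inter> intercalate h i j = {x \<in> intercalate h i j. colour h x < k}" if "i < h" "j < h" for i j
    using intercalate_latin_trade[OF that] unfolding D_def latin_trade_def n by blast
  then have "card (D \<inter> intercalate h i j) = k" if "i < h" "j < h" for i j
    using card_colours_intercalate[OF that \<open>k \<le> 4\<close>] that by simp
  then have "card D = (\<Sum>(i, j)\<in>{..<h} \<times> {..<h}. k)"
    unfolding card_eq_sum_intercalates[OF \<open>D \<subseteq> _\<close> \<open>h > 0\<close>] by (intro sum.cong) auto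
  then have "card D = h * h * k" by (simp add: case_prod_unfold)
  moreover have "strong_defining_set k n (back_circulant n) D"
  proof (rule strong_defining_setI[OF latin_square_back_circulant _ \<open>1 \<le> k\<close>])
    show "D \<subseteq> back_circulant n" unfolding D_def by blast
    fix T assume T: "latin_trade n (back_circulant n) T"
    then have "finite T" and sub: "T \<subseteq> back_circulant n"
      unfolding latin_trade_def using finite_partial_latin_square by auto
    \<comment> \<open>A trade contains every colour, and cells of distinct colours are
      distinct.\<close>
    have "{..<k} \<subseteq> colour h ` (D \<inter> T)"
    proof
      fix t assume "t \<in> {..<k}"
      then have "t < k" "t < 4" using \<open>k \<le> 4\<close> by auto
      then obtain x where "x \<in> T" "colour h x = t"
        using latin_trade_meets_colour[OF T[unfolded n] \<open>h > 0\<close>] by blast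
      with \<open>t < k\<close> sub show "t \<in> colour h ` (D \<inter> T)" unfolding D_def by blast
    qed
    then show "k \<le> card (D \<inter> T)"
      using \<open>finite T\<close> surj_card_le[of "D \<inter> T" "{..<k}"] by simp
  qed
  ultimately show "\<exists>D. strong_defining_set k n (back_circulant n) D \<and>
      real (card D) = real k * real n ^ 2 / 4"
    unfolding size by (intro exI[of _ D]) simp

  fix E assume E: "strong_defining_set k n (back_circulant n) E"
  then have sub: "E \<subseteq> back_circulant (2 * h)"
    unfolding strong_defining_set_def defining_set_def n by blast
  \<comment> \<open>Each of the \<open>h * h\<close> disjoint intercalates is a trade and so claims
    \<open>k\<close> cells of \<open>E\<close>.\<close>
  have "k \<le> card (E \<inter> intercalate h i j)" if "i < h" "j < h" for i j
    using E intercalate_latin_trade[OF that] unfolding strong_defining_set_def n by blast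
  then have "(\<Sum>(i, j)\<in>{..<h} \<times> {..<h}. k) \<le> card E"
    unfolding card_eq_sum_intercalates[OF sub \<open>h > 0\<close>] by (intro sum_mono) auto
  then show "real k * real n ^ 2 / 4 \<le> real (card E)"
    unfolding size by (simp only: of_nat_le_iff) (simp add: case_prod_unfold)
qed

end
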